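(* For any integers $k\ge 2$, $g\ge 3$ and any $\epsilon>0$, there exists a signed graph $(G,\sigma)$ of girth at least $g$ such that $\chi(G)=k$ and $\chi_c(G,\sigma)>2k-\epsilon$.
   Context: A signed graph $(G,\sigma)$ is a finite graph $G$ (multiple edges allowed, no loops) with a signature $\sigma:E(G)\to\{+1,-1\}$. $\chi(G)$ is the chromatic number of the underlying graph $G$. For real $r\ge 2$, $C^r$ is the circle of circumference $r$, $d_{C^r}(x,y)=\min\{|x-y|,r-|x-y|\}$, and $\overline{x}=x+r/2\pmod r$. A circular $r$-coloring of $(G,\sigma)$ is $f:V(G)\to C^r$ with $d_{C^r}(f(u),f(v))\ge1$ for each positive edge $uv$ and $d_{C^r}(f(u),\overline{f(v)})\ge1$ for each negative edge $uv$; $\chi_c(G,\sigma)$ is the infimum of $r\ge 2$ for which such a coloring exists. *)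

theory Defs
  imports Complex_Main
begin

text \<open>Finite graphs on vertex set V (vertices are naturals), edges are 2-element subsets of V.
  Girth at least 3 excludes parallel edges, so simple graphs suffice.
  A signature assigns to each edge a sign: True = positive, False = negative.\<close>

definition graph :: "nat set \<Rightarrow> nat set set \<Rightarrow> bool" where
  "graph V E \<longleftrightarrow> finite V \<and> (\<forall>e\<in>E. \<exists>u v. e = {u, v} \<and> u \<noteq> v \<and> u \<in> V \<and> v \<in> V)"

definition is_cycle :: "nat set set \<Rightarrow> nat list \<Rightarrow> bool" where
  "is_cycle E cs \<longleftrightarrow> length cs \<ge> 3 \<and> distinct cs \<and>
     (\<forall>i < length cs. {cs ! i, cs ! ((i + 1) mod length cs)} \<in> E)"

definition girth_ge :: "nat set set \<Rightarrow> nat \<Rightarrow> bool" where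
  "girth_ge E g \<longleftrightarrow> (\<forall>cs. is_cycle E cs \<longrightarrow> length cs \<ge> g)"

definition proper_coloring :: "nat set \<Rightarrow> nat set set \<Rightarrow> nat \<Rightarrow> (nat \<Rightarrow> nat) \<Rightarrow> bool" where
  "proper_coloring V E k c \<longleftrightarrow> (\<forall>v\<in>V. c v < k) \<and> (\<forall>u v. {u, v} \<in> E \<longrightarrow> c u \<noteq> c v)"

definition chromatic_number :: "nat set \<Rightarrow> nat set set \<Rightarrow> nat" where
  "chromatic_number V E = (LEAST k. \<exists>c. proper_coloring V E k c)"

text \<open>The circle C^r represented by [0, r).\<close>
definition circ_dist :: "real \<Rightarrow> real \<Rightarrow> real \<Rightarrow> real" where
  "circ_dist r x y = min \<bar>x - y\<bar> (r - \<bar>x - y\<bar>)"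

definition antipode :: "real \<Rightarrow> real \<Rightarrow> real" where
  "antipode r x = (if x + r / 2 < r then x + r / 2 else x + r / 2 - r)"

definition circular_coloring ::
  "nat set \<Rightarrow> nat set set \<Rightarrow> (nat set \<Rightarrow> bool) \<Rightarrow> real \<Rightarrow> (nat \<Rightarrow> real) \<Rightarrow> bool" where
  "circular_coloring V E \<sigma> r f \<longleftrightarrow>
     (\<forall>v\<in>V. 0 \<le> f v \<and> f v < r) \<and>
     (\<forall>u v. {u, v} \<in> E \<longrightarrow>
        (if \<sigma> {u, v} then circ_dist r (f u) (f v) \<ge> 1
         else circ_dist r (f u) (antipode r (f v)) \<ge> 1))"

definition circular_chromatic_number ::
  "nat set \<Rightarrow> nat set set \<Rightarrow> (nat set \<Rightarrow> bool) \<Rightarrow> real" where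
  "circular_chromatic_number V E \<sigma> = Inf {r. r \<ge> 2 \<and> (\<exists>f. circular_coloring V E \<sigma> r f)}"

end

theory Submission
  imports Defs
begin

text \<open>
  The graph is \<open>k\<close>-partite, so \<open>\<chi> = k\<close> and \<open>\<chi>\<^sub>c \<le> 2k\<close>, with the property that any two not too
  small subsets of distinct parts are joined both by a positive and by a negative edge. Cut the
  circle \<open>C\<^sup>r\<close> of a circular colouring into \<open>m\<close> short arcs and pick in each part an arc that carries at
  least a fraction \<open>1/m\<close> of the vertices. Both signs occur between the chosen classes, so modulo \<open>r/2\<close>
  the \<open>k\<close> arcs are pairwise at distance almost 1; hence \<open>r/2\<close> is almost at least \<open>k\<close>. The lower bound
  on \<open>\<chi>\<^sub>c\<close> also gives \<open>\<chi> \<ge> k\<close>, because a proper \<open>q\<close>-colouring is a circular \<open>2q\<close>-colouring.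

  The graph itself is built greedily: call a triple of two large sets in distinct parts and a
  sign unhit if no edge serves it. With bounded degree \<open>D\<close> and linearly many edges, a constant
  fraction of all signed pairs in each unhit triple joins unsaturated vertices at distance more
  than \<open>g\<close>. By double counting, some such signed edge serves a constant fraction of the unhit
  triples. There are only exponentially many triples, so linearly many edges serve all of them.
\<close>

section \<open>Balls in the graph metric, and girth\<close>

primrec near :: "nat set set \<Rightarrow> nat \<Rightarrow> nat \<Rightarrow> nat set" where
  "near E 0 x = {x}"
| "near E (Suc l) x = near E l x \<union> {z. \<exists>y\<in>near E l x. {y, z} \<in> E}"

lemma near_mono: "l \<le> l' \<Longrightarrow> near E l x \<subseteq> near E l' x"
  by (induction l' rule: nat_induct) (auto simp: le_Suc_eq)

text \<open>The recursion lengthens a walk at its far end; symmetry of \<open>near\<close> also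
  requires lengthening it at the centre.\<close>

lemma near_prepend: "\<lbrakk>y \<in> near E l x; {x, z} \<in> E\<rbrakk> \<Longrightarrow> y \<in> near E (Suc l) z"
proof (induction l arbitrary: y)
  case 0
  then show ?case by (auto simp: insert_commute)
next
  case (Suc l)
  from Suc.prems(1) consider "y \<in> near E l x" | y' where "y' \<in> near E l x" "{y', y} \<in> E"
    by auto
  then show ?case
  proof cases
    case 1
    then show ?thesis using Suc.IH[OF 1 Suc.prems(2)] by simp
  next
    case 2
    then show ?thesis using Suc.IH[OF 2(1) Suc.prems(2)] by (auto simp del: near.simps simp: near.simps(2)[of E "Suc l"])
  qed
qed

lemma near_sym: "y \<in> near E l x \<Longrightarrow> x \<in> near E l y"
proof (induction l arbitrary: y)
  case (Suc l)
  from Suc.prems consider "y \<in> near E l x" | y' where "y' \<in> near E l x" "{y', y} \<in> E"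
    by auto
  then show ?case
  proof cases
    case 1
    then show ?thesis using Suc.IH by auto
  next
    case 2
    then show ?thesis using Suc.IH near_prepend by blast
  qed
qed auto

lemma walk_near:
  assumes "\<And>i. i < l \<Longrightarrow> {p i, p (Suc i)} \<in> E"
  shows "p l \<in> near E l (p 0)"
  using assms by (induction l) auto

text \<open>The neighbours of a point inject into the at most \<open>D\<close> edges at it, so each
  step multiplies the size of the ball by at most D + 1.\<close>

lemma card_near:
  assumes "finite E" and deg: "\<And>x. card {e \<in> E. x \<in> e} \<le> D"
  shows "finite (near E l x) \<and> card (near E l x) \<le> (D + 1) ^ l"
proof (induction l)
  case (Suc l)
  have nb: "finite {z. {y, z} \<in> E} \<and> card {z. {y, z} \<in> E} \<le> D" for y
  proof -
    have inj: "inj_on (\<lambda>z. {y, z}) {z. {y, z} \<in> E}"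
      by (auto simp: inj_on_def doubleton_eq_iff)
    have sub: "(\<lambda>z. {y, z}) ` {z. {y, z} \<in> E} \<subseteq> {e \<in> E. y \<in> e}" by auto
    have fin: "finite {e \<in> E. y \<in> e}" using assms(1) by simp
    show ?thesis
      using finite_subset[OF sub fin] finite_imageD[OF _ inj] card_inj_on_le[OF inj sub fin] deg[of y]
      by auto
  qed
  have eq: "near E (Suc l) x = (\<Union>y\<in>near E l x. insert y {z. {y, z} \<in> E})" by auto
  have "card (near E (Suc l) x) \<le> (\<Sum>y\<in>near E l x. card (insert y {z. {y, z} \<in> E}))"
    unfolding eq using Suc by (intro card_UN_le) auto
  also have "\<dots> \<le> (\<Sum>y\<in>near E l x. D + 1)"
    using nb by (intro sum_mono) (auto simp: card_insert_if le_SucI)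
  also have "\<dots> \<le> (D + 1) ^ Suc l"
    using mult_le_mono1[of "card (near E l x)" "(D + 1) ^ l" "D + 1"] Suc by (simp add: mult.commute)
  finally show ?case unfolding eq using Suc nb by auto
qed auto

text \<open>A cycle shorter than \<open>g\<close> must use the new edge. The rest of it is a walk in
  \<open>E\<close> between \<open>u\<close> and \<open>v\<close> with fewer than \<open>g\<close>
  edges, so \<open>v\<close> would lie in the ball.\<close>

lemma girth_ge_insert:
  assumes g: "girth_ge E g" and far: "v \<notin> near E g u"
  shows "girth_ge (insert {u, v} E) g"
  unfolding girth_ge_def
proof (intro allI impI, rule ccontr)
  fix cs assume cyc: "is_cycle (insert {u, v} E) cs" and short: "\<not> g \<le> length cs"
  let ?L = "length cs"
  have L: "?L \<ge> 3" and dist: "distinct cs"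
    and ed: "\<And>i. i < ?L \<Longrightarrow> {cs ! i, cs ! ((i + 1) mod ?L)} \<in> insert {u, v} E"
    using cyc by (auto simp: is_cycle_def)
  have "\<not> is_cycle E cs" using g short by (auto simp: girth_ge_def)
  then obtain i where i: "i < ?L" "{cs ! i, cs ! ((i + 1) mod ?L)} \<notin> E"
    using L dist by (auto simp: is_cycle_def)
  then have iuv: "{cs ! i, cs ! ((i + 1) mod ?L)} = {u, v}" using ed[OF i(1)] by auto
  have other: "{cs ! j, cs ! ((j + 1) mod ?L)} \<in> E" if j: "j < ?L" "j \<noteq> i" for j
  proof -
    have "{cs ! j, cs ! ((j + 1) mod ?L)} \<noteq> {u, v}"
    proof
      assume "{cs ! j, cs ! ((j + 1) mod ?L)} = {u, v}"
      then have "{cs ! j, cs ! ((j + 1) mod ?L)} = {cs ! i, cs ! ((i + 1) mod ?L)}"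
        using iuv by simp
      \<comment> \<open>The vertices are distinct and j differs from i, so the two edges can only
        agree with ends swapped. Then i and j would be cyclic successors of each other, impossible
        for length at least 3.\<close>
      then have "cs ! j = cs ! ((i + 1) mod ?L) \<and> cs ! ((j + 1) mod ?L) = cs ! i"
        using dist j i(1) by (auto simp: doubleton_eq_iff nth_eq_iff_index_eq)
      moreover have "0 < ?L" using L by linarith
      ultimately have "j = (i + 1) mod ?L" "(j + 1) mod ?L = i"
        using dist j i(1) by (auto simp: nth_eq_iff_index_eq)
      then show False using L i(1) j(1) by (auto simp: mod_if split: if_splits)
    qed
    then show ?thesis using ed[OF j(1)] by auto
  qed
  \<comment> \<open>The way around the cycle from the successor of position i back to i, avoiding
    only the edge at i.\<close>
  define p where "p j = cs ! ((i + 1 + j) mod ?L)" for j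
  have "p (?L - 1) \<in> near E (?L - 1) (p 0)"
  proof (rule walk_near)
    fix j assume j: "j < ?L - 1"
    have "(i + 1 + j) mod ?L \<noteq> i" using j i(1) by (auto simp: mod_if split: if_splits)
    moreover have "(i + 1 + j) mod ?L < ?L" using L by (intro mod_less_divisor) linarith
    ultimately have "{cs ! ((i + 1 + j) mod ?L), cs ! (((i + 1 + j) mod ?L + 1) mod ?L)} \<in> E"
      using other by blast
    then show "{p j, p (Suc j)} \<in> E" unfolding p_def by (simp add: mod_Suc_eq)
  qed
  moreover have "p (?L - 1) = cs ! i"
  proof -
    have "i + 1 + (?L - 1) = i + ?L" using L by linarith
    then show ?thesis using i(1) unfolding p_def by simp
  qed
  moreover have "p 0 = cs ! ((i + 1) mod ?L)" by (simp add: p_def)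
  ultimately have "cs ! i \<in> near E g (cs ! ((i + 1) mod ?L))"
    using near_mono[of "?L - 1" g] short by (metis One_nat_def diff_le_self nat_le_linear order.trans subsetD)
  then have "v \<in> near E g u" using iuv near_sym by (auto simp: doubleton_eq_iff)
  with far show False by simp
qed

section \<open>Handshake count and the choice of one greedy edge\<close>

lemma card_saturated:
  assumes "graph V E" and "finite E"
  shows "card {x \<in> V. D \<le> card {e \<in> E. x \<in> e}} * D \<le> 2 * card E"
proof -
  have fV: "finite V" using assms(1) by (simp add: graph_def)
  let ?X = "{x \<in> V. D \<le> card {e \<in> E. x \<in> e}}"
  have "card ?X * D = (\<Sum>x\<in>?X. D)" by simp
  also have "\<dots> \<le> (\<Sum>x\<in>?X. card {e \<in> E. x \<in> e})" by (intro sum_mono) auto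
  also have "\<dots> \<le> (\<Sum>x\<in>V. card {e \<in> E. x \<in> e})" using fV by (intro sum_mono2) auto
  also have "\<dots> = (\<Sum>e\<in>E. card {x \<in> V. x \<in> e})"
    using sum.swap_restrict[OF fV assms(2), of "\<lambda>_ _. 1::nat" "\<lambda>x e. x \<in> e"] by simp
  also have "\<dots> \<le> (\<Sum>e\<in>E. 2)"
  proof (rule sum_mono)
    fix e assume "e \<in> E"
    then obtain u v where "e = {u, v}" using assms(1) by (auto simp: graph_def)
    then have "{x \<in> V. x \<in> e} \<subseteq> {u, v}" by auto
    then have "card {x \<in> V. x \<in> e} \<le> card {u, v}" by (rule card_mono[rotated]) simp
    also have "\<dots> \<le> 2" by (simp add: card_insert_if)
    finally show "card {x \<in> V. x \<in> e} \<le> 2" .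
  qed
  finally show ?thesis by simp
qed

text \<open>Every triple in \<open>U\<close> is served by at least 2h * h admissible signed pairs,
  and there are at most 2(wh)^2 such pairs altogether. By averaging, one pair serves a fraction
  1/w^2 of \<open>U\<close>.\<close>

lemma greedy_step:
  fixes U :: "(nat set \<times> nat set \<times> bool) set"
  assumes gr: "graph V E" and fE: "finite E" and deg: "\<And>x. card {e \<in> E. x \<in> e} \<le> D"
    and fU: "finite U" and U0: "U \<noteq> {}"
    and U: "\<forall>(A, B, s)\<in>U. A \<subseteq> V \<and> B \<subseteq> V \<and> 4 * h \<le> card A \<and> 4 * h \<le> card B"
    and V: "card V \<le> w * h" and E: "card E \<le> D * h" and D: "D > 0"
    and h: "(D + 1) ^ g \<le> h"
  obtains a b s where "card U \<le> w\<^sup>2 * card {(A, B, s') \<in> U. a \<in> A \<and> b \<in> B \<and> s' = s}"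
    and "card {e \<in> E. a \<in> e} < D" "card {e \<in> E. b \<in> e} < D" "b \<notin> near E g a" "a \<in> V" "b \<in> V"
proof -
  have fV: "finite V" using gr by (simp add: graph_def)
  define X where "X = {x \<in> V. D \<le> card {e \<in> E. x \<in> e}}"
  have "card X * D \<le> 2 * (D * h)" using card_saturated[OF gr fE, of D] E unfolding X_def by linarith
  then have X: "card X \<le> 2 * h" using D by (simp add: mult.commute mult.left_commute)
  have fX: "finite X" using fV by (simp add: X_def)
  have h0: "h > 0" using h by (metis add_gr_0 less_le_trans zero_less_one zero_less_power)
  define P where "P = {(a, b, s :: bool). a \<in> V - X \<and> b \<in> V - X \<and> b \<notin> near E g a}"
  define hits where "hits = (\<lambda>(a :: nat, b :: nat, s :: bool) (A, B, s'). a \<in> A \<and> b \<in> B \<and> s' = s)"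
  have Psub: "P \<subseteq> V \<times> V \<times> UNIV" by (auto simp: P_def)
  have fP: "finite P" using finite_subset[OF Psub] fV by simp
  have "card P \<le> card (V \<times> V \<times> (UNIV :: bool set))" using Psub fV by (intro card_mono) auto
  also have "\<dots> = 2 * (card V)\<^sup>2" by (simp add: card_cartesian_product power2_eq_square)
  also have "\<dots> \<le> 2 * (w * h)\<^sup>2" using V by (intro mult_le_mono2 power_mono) auto
  finally have cP: "card P \<le> 2 * (w * h)\<^sup>2" .
  \<comment> \<open>At most 2h points are saturated and a ball has at most h points. So A keeps 2h
    of its 4h points, and for each of them B keeps 4h - 2h - h = h.\<close>
  have many: "2 * h\<^sup>2 \<le> card {p \<in> P. hits p T}" if "T \<in> U" for T
  proof -
    obtain A B s where T: "T = (A, B, s)" by (cases T)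
    have AB: "A \<subseteq> V" "B \<subseteq> V" "4 * h \<le> card A" "4 * h \<le> card B" using U that T by auto
    let ?S = "SIGMA a : A - X. B - X - near E g a"
    have cA: "2 * h \<le> card (A - X)" using diff_card_le_card_Diff[OF fX, of A] AB X by linarith
    have cB: "h \<le> card (B - X - near E g a)" for a
    proof -
      have n: "finite (near E g a)" "card (near E g a) \<le> h"
        using card_near[OF fE deg, of g a] h by auto
      show ?thesis using diff_card_le_card_Diff[OF fX, of B] diff_card_le_card_Diff[OF n(1), of "B - X"] AB X n(2)
        by linarith
    qed
    have fA: "finite A" "finite B" using AB fV finite_subset by blast+
    have "2 * h\<^sup>2 \<le> card (A - X) * h" using cA by (simp add: power2_eq_square)
    also have "\<dots> = (\<Sum>a\<in>A - X. h)" by simp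
    also have "\<dots> \<le> (\<Sum>a\<in>A - X. card (B - X - near E g a))" using cB by (intro sum_mono) auto
    also have "\<dots> = card ?S" using fA by (subst card_SigmaI) auto
    also have "\<dots> \<le> card {p \<in> P. hits p T}"
    proof (rule card_inj_on_le)
      show "inj_on (\<lambda>(a, b). (a, b, s)) ?S" by (auto simp: inj_on_def)
      show "(\<lambda>(a, b). (a, b, s)) ` ?S \<subseteq> {p \<in> P. hits p T}"
        using AB by (auto simp: P_def hits_def T)
    qed (use fP in simp)
    finally show ?thesis .
  qed
  have dc: "(\<Sum>p\<in>P. card {T \<in> U. hits p T}) = (\<Sum>T\<in>U. card {p \<in> P. hits p T})"
    using sum.swap_restrict[OF fP fU, of "\<lambda>_ _. 1::nat" hits] by simp
  have "card U * (2 * h\<^sup>2) \<le> (\<Sum>T\<in>U. card {p \<in> P. hits p T})"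
    using sum_mono[of U "\<lambda>_. 2 * h\<^sup>2" "\<lambda>T. card {p \<in> P. hits p T}"] many by simp
  then have tot: "card U * (2 * h\<^sup>2) \<le> (\<Sum>p\<in>P. card {T \<in> U. hits p T})" using dc by simp
  have "\<exists>p\<in>P. card U \<le> w\<^sup>2 * card {T \<in> U. hits p T}"
  proof (rule ccontr)
    assume "\<not> ?thesis"
    then have less: "w\<^sup>2 * card {T \<in> U. hits p T} < card U" if "p \<in> P" for p using that by auto
    obtain T where "T \<in> U" using U0 by auto
    then have "card {p \<in> P. hits p T} > 0" using many[of T] h0 by (metis le_zero_eq mult_is_0 neq0_conv power_not_zero zero_neq_numeral)
    then have P0: "P \<noteq> {}" by auto
    have "w\<^sup>2 * (card U * (2 * h\<^sup>2)) \<le> (\<Sum>p\<in>P. w\<^sup>2 * card {T \<in> U. hits p T})"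
      using tot by (simp add: sum_distrib_left[symmetric])
    also have "\<dots> < (\<Sum>p\<in>P. card U)" using less fP P0 by (intro sum_strict_mono) auto
    also have "\<dots> \<le> 2 * (w * h)\<^sup>2 * card U" using cP by simp
    finally show False by (simp add: power_mult_distrib algebra_simps)
  qed
  then obtain a b s where p: "(a, b, s) \<in> P" "card U \<le> w\<^sup>2 * card {T \<in> U. hits (a, b, s) T}"
    by auto
  show ?thesis
  proof (rule that)
    show "card U \<le> w\<^sup>2 * card {(A, B, s') \<in> U. a \<in> A \<and> b \<in> B \<and> s' = s}"
      using p(2) by (simp add: hits_def case_prod_unfold)
  qed (use p(1) in \<open>auto simp: P_def X_def\<close>)
qed

section \<open>Sparse signed graphs meeting a family of triples\<close>

definition unhit :: "(nat set \<times> nat set \<times> bool) set \<Rightarrow> (nat set \<times> bool) set \<Rightarrow> (nat set \<times> nat set \<times> bool) set"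
  where "unhit U S = {(A, B, s) \<in> U. \<not> (\<exists>a\<in>A. \<exists>b\<in>B. ({a, b}, s) \<in> S)}"

text \<open>Injectivity of \<open>fst\<close> gives each edge a single sign. The last clause
  remembers that edges come from triples of \<open>U\<close>, which later makes the partition into
  parts a proper colouring.\<close>

definition sparse_signed ::
  "nat set \<Rightarrow> (nat set \<times> nat set \<times> bool) set \<Rightarrow> nat \<Rightarrow> nat \<Rightarrow> (nat set \<times> bool) set \<Rightarrow> bool" where
  "sparse_signed V U D g S \<longleftrightarrow> finite S \<and> inj_on fst S \<and> graph V (fst ` S) \<and> girth_ge (fst ` S) g \<and>
     (\<forall>x. card {e \<in> fst ` S. x \<in> e} \<le> D) \<and>
     (\<forall>e\<in>fst ` S. \<exists>(A, B, s)\<in>U. \<exists>a\<in>A. \<exists>b\<in>B. e = {a, b})"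

text \<open>The pair found by \<open>greedy_step\<close> becomes an edge: lying outside the ball
  keeps the girth, unsaturated ends keep the degree bound. If no triple is left, \<open>S\<close>
  stays unchanged.\<close>

lemma sparse_signed_step:
  assumes S: "sparse_signed V U D g S" and fU: "finite U"
    and U: "\<forall>(A, B, s)\<in>U. A \<subseteq> V \<and> B \<subseteq> V \<and> 4 * h \<le> card A \<and> 4 * h \<le> card B"
    and V: "card V \<le> w * h" and cS: "card S \<le> D * h" and D: "D > 0"
    and h: "(D + 1) ^ g \<le> h" and g: "g > 0" and w: "w > 0"
  obtains S' where "sparse_signed V U D g S'" "card S' \<le> Suc (card S)"
    "real (card (unhit U S')) \<le> (1 - 1 / real (w\<^sup>2)) * real (card (unhit U S))"
proof (cases "unhit U S = {}")
  case True
  then show ?thesis using that[of S] S by simp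
next
  case False
  let ?E = "fst ` S"
  have fS: "finite S" and gr: "graph V ?E" and inj: "inj_on fst S" and gi: "girth_ge ?E g"
    and deg: "\<And>x. card {e \<in> ?E. x \<in> e} \<le> D"
    and fromU: "\<forall>e\<in>?E. \<exists>(A, B, s)\<in>U. \<exists>a\<in>A. \<exists>b\<in>B. e = {a, b}"
    using S by (auto simp: sparse_signed_def)
  have sub: "unhit U S \<subseteq> U" by (auto simp: unhit_def)
  have fh: "finite (unhit U S)" using sub fU finite_subset by blast
  have fE: "finite ?E" using fS by simp
  have cE: "card ?E \<le> D * h" using card_image_le[OF fS, of fst] cS by linarith
  have U': "\<forall>(A, B, s)\<in>unhit U S. A \<subseteq> V \<and> B \<subseteq> V \<and> 4 * h \<le> card A \<and> 4 * h \<le> card B"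
    by (intro ballI bspec[OF U] subsetD[OF sub])
  obtain a b s where
    many: "card (unhit U S) \<le> w\<^sup>2 * card {(A, B, s') \<in> unhit U S. a \<in> A \<and> b \<in> B \<and> s' = s}"
    and da: "card {e \<in> ?E. a \<in> e} < D" and db: "card {e \<in> ?E. b \<in> e} < D"
    and far: "b \<notin> near ?E g a" and ab: "a \<in> V" "b \<in> V"
    using greedy_step[OF gr fE deg fh False U' V cE D h] by blast
  let ?H = "{(A, B, s') \<in> unhit U S. a \<in> A \<and> b \<in> B \<and> s' = s}"
  let ?S = "insert ({a, b}, s) S"
  \<comment> \<open>Since g > 0, the ball contains a and its neighbours, so the added pair is
    neither a loop nor an edge that already has a sign.\<close>
  have "near ?E 0 a \<subseteq> near ?E g a" "near ?E (Suc 0) a \<subseteq> near ?E g a"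
    using g by (intro near_mono; simp)+
  then have new: "a \<noteq> b" "{a, b} \<notin> ?E" using far by auto
  have H0: "?H \<noteq> {}"
  proof
    assume "?H = {}"
    then have "card (unhit U S) = 0" using many by (metis card.empty le_zero_eq mult_0_right)
    then show False using False fh by simp
  qed
  have d: "card {e \<in> insert {a, b} ?E. x \<in> e} \<le> D" for x
  proof (cases "x \<in> {a, b}")
    case True
    then have eq: "{e \<in> insert {a, b} ?E. x \<in> e} = insert {a, b} {e \<in> ?E. x \<in> e}" by auto
    have "card {e \<in> ?E. x \<in> e} < D" using True da db by blast
    then show ?thesis unfolding eq using D by (intro card_insert_le_m1) linarith+
  next
    case False
    then have "{e \<in> insert {a, b} ?E. x \<in> e} = {e \<in> ?E. x \<in> e}" by auto
    then show ?thesis using deg by metis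
  qed
  have new_S: "sparse_signed V U D g ?S"
    unfolding sparse_signed_def image_insert fst_conv
  proof (intro conjI allI d)
    show "inj_on fst ?S" using inj new by (force simp: inj_on_def)
    show "graph V (insert {a, b} ?E)" using gr ab new by (auto simp: graph_def)
    show "girth_ge (insert {a, b} ?E) g" using girth_ge_insert[OF gi far] .
    show "\<forall>e\<in>insert {a, b} ?E. \<exists>(A, B, s)\<in>U. \<exists>a\<in>A. \<exists>b\<in>B. e = {a, b}"
    proof -
      obtain A B where "(A, B, s) \<in> U" "a \<in> A" "b \<in> B" using H0 sub by blast
      then have "\<exists>(A, B, s)\<in>U. \<exists>a'\<in>A. \<exists>b'\<in>B. {a, b} = {a', b'}"
        by (intro bexI[of _ "(A, B, s)"]) auto
      with fromU show ?thesis by (simp only: ball_simps)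
    qed
  qed (use fS in simp)
  have "card (unhit U ?S) \<le> card (unhit U S - ?H)"
    using fh by (intro card_mono) (auto simp: unhit_def)
  also have "\<dots> = card (unhit U S) - card ?H"
    using fh by (intro card_Diff_subset) (auto intro: finite_subset)
  finally have c: "card (unhit U ?S) \<le> card (unhit U S) - card ?H" .
  have "card ?H \<le> card (unhit U S)" using fh by (intro card_mono) auto
  with c have c: "real (card (unhit U ?S)) \<le> real (card (unhit U S)) - real (card ?H)" by linarith
  have "real (card (unhit U S)) \<le> real (w\<^sup>2) * real (card ?H)"
    using many by (simp only: of_nat_le_iff flip: of_nat_mult)
  then have "real (card (unhit U S)) / real (w\<^sup>2) \<le> real (card ?H)"
    using w by (simp add: field_simps)
  with c have "real (card (unhit U ?S)) \<le> (1 - 1 / real (w\<^sup>2)) * real (card (unhit U S))"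
    by (simp add: algebra_simps)
  then show ?thesis using that[of ?S] new_S fS by (simp add: card_insert_if)
qed

text \<open>Every w^2 steps at least halve the bound on the number of unhit triples, initially at
  most 2^(2wh + 1). After w^2 (2wh + 2) steps it is at most 1/2, so none is left.\<close>

lemma sparse_signed_hitting:
  assumes fV: "finite V" and fU: "finite U"
    and U: "\<forall>(A, B, s)\<in>U. A \<subseteq> V \<and> B \<subseteq> V \<and> 4 * h \<le> card A \<and> 4 * h \<le> card B"
    and V: "card V \<le> w * h" and h: "(4 * w ^ 3 + 1) ^ g \<le> h" and g: "g > 0" and w: "w > 0"
  obtains S where "sparse_signed V U (4 * w ^ 3) g S" "unhit U S = {}"
proof -
  \<comment> \<open>The degree bound leaves room for \<open>?T\<close> edges: w^2 (2wh + 2) <= 4 w^3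
    h, as the greedy step requires \<open>card S \<le> ?D * h\<close>.\<close>
  let ?D = "4 * w ^ 3" and ?T = "w\<^sup>2 * (2 * (w * h) + 2)"
  have D: "?D > 0" using w by simp
  have h0: "h > 0" using h by (metis add_gr_0 less_le_trans zero_less_one zero_less_power)
  have "2 \<le> 2 * (w * h)" using w h0 by (simp add: Suc_leI)
  then have "?T \<le> w\<^sup>2 * (4 * (w * h))" by (intro mult_le_mono2) linarith
  also have "\<dots> = ?D * h" by (simp add: power2_eq_square power3_eq_cube)
  finally have T: "?T \<le> ?D * h" .
  have ex: "\<exists>S. sparse_signed V U ?D g S \<and> card S \<le> t \<and>
      real (card (unhit U S)) \<le> (1 - 1 / real (w\<^sup>2)) ^ t * real (card U)" if "t \<le> ?T" for t
    using that
  proof (induction t)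
    case 0
    have "sparse_signed V U ?D g {}" using fV
      by (auto simp: sparse_signed_def graph_def girth_ge_def is_cycle_def dest: spec[of _ 0])
    moreover have "unhit U {} = U" by (auto simp: unhit_def)
    ultimately show ?case by (intro exI[of _ "{}"]) simp
  next
    case (Suc t)
    then obtain S where S: "sparse_signed V U ?D g S" "card S \<le> t"
      "real (card (unhit U S)) \<le> (1 - 1 / real (w\<^sup>2)) ^ t * real (card U)" by auto
    have "card S \<le> ?D * h" using S(2) Suc.prems T by linarith
    from sparse_signed_step[OF S(1) fU U V this D h g w]
    obtain S' where S': "sparse_signed V U ?D g S'" "card S' \<le> Suc (card S)"
      "real (card (unhit U S')) \<le> (1 - 1 / real (w\<^sup>2)) * real (card (unhit U S))" by blast
    have "1 / real (w\<^sup>2) \<le> 1" using w by simp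
    then have "(1 - 1 / real (w\<^sup>2)) * real (card (unhit U S)) \<le>
        (1 - 1 / real (w\<^sup>2)) * ((1 - 1 / real (w\<^sup>2)) ^ t * real (card U))"
      using S(3) by (intro mult_left_mono) auto
    with S' S(2) show ?case by (intro exI[of _ S']) (auto simp: mult.assoc)
  qed
  obtain S where S: "sparse_signed V U ?D g S"
      "real (card (unhit U S)) \<le> (1 - 1 / real (w\<^sup>2)) ^ ?T * real (card U)"
    using ex[of ?T] by auto
  have "U \<subseteq> Pow V \<times> Pow V \<times> UNIV" using U by auto
  then have "card U \<le> card (Pow V \<times> Pow V \<times> (UNIV :: bool set))" using fV by (intro card_mono) auto
  also have "\<dots> = 2 ^ (2 * card V + 1)"
    using fV by (simp add: card_cartesian_product card_Pow power_mult power2_eq_square power_add mult_2)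
  also have "\<dots> \<le> 2 ^ (2 * (w * h) + 1)" using V by (intro power_increasing) auto
  finally have cU: "real (card U) \<le> 2 ^ (2 * (w * h) + 1)" by (metis of_nat_le_iff of_nat_numeral of_nat_power)
  have half: "(1 - 1 / real (w\<^sup>2)) ^ w\<^sup>2 \<le> 1 / 2"
  proof -
    have "(1 - 1 / real (w\<^sup>2)) ^ w\<^sup>2 \<le> exp (- 1 / real (w\<^sup>2)) ^ w\<^sup>2"
      using exp_ge_add_one_self[of "- 1 / real (w\<^sup>2)"] w by (intro power_mono) auto
    also have "\<dots> = exp (- 1)" using w by (simp add: exp_of_nat_mult[symmetric])
    also have "\<dots> \<le> 1 / 2" using exp_ge_add_one_self[of 1] by (simp add: exp_minus field_simps)
    finally show ?thesis .
  qed
  have "(1 - 1 / real (w\<^sup>2)) ^ ?T = ((1 - 1 / real (w\<^sup>2)) ^ w\<^sup>2) ^ (2 * (w * h) + 2)"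
    by (rule power_mult)
  also have "\<dots> \<le> (1 / 2) ^ (2 * (w * h) + 2)" using half w by (intro power_mono) auto
  finally have "(1 - 1 / real (w\<^sup>2)) ^ ?T * real (card U) \<le> (1 / 2) ^ (2 * (w * h) + 2) * 2 ^ (2 * (w * h) + 1)"
    using cU by (intro mult_mono) auto
  also have "\<dots> = 1 / 2" by (simp add: power_one_over field_simps)
  finally have "card (unhit U S) = 0" using S(2) by linarith
  moreover have "finite (unhit U S)" using fU by (auto simp: unhit_def intro: finite_subset[OF _ fU])
  ultimately show ?thesis using that S(1) by simp
qed

section \<open>The upper bound from proper colourings\<close>

lemma circular_coloring_of_proper:
  assumes "graph V E" and c: "proper_coloring V E q c"
  shows "circular_coloring V E \<sigma> (2 * real q) (\<lambda>v. real (c v))"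
  unfolding circular_coloring_def
proof (intro conjI ballI allI impI)
  fix v assume "v \<in> V"
  then show "real (c v) < 2 * real q" using c by (auto simp: proper_coloring_def)
next
  fix u v assume e: "{u, v} \<in> E"
  then have "u \<in> V" "v \<in> V" using assms(1) by (auto simp: graph_def doubleton_eq_iff)
  then have "c u < q" "c v < q" "c u \<noteq> c v" using c e by (auto simp: proper_coloring_def)
  then have "1 \<le> \<bar>real (c u) - real (c v)\<bar>" "real (c u) + 1 \<le> real q" "real (c v) + 1 \<le> real q"
    by linarith+
  \<comment> \<open>The colours 0, ..., q - 1 lie in one half of the circle of length 2q, their
    antipodes q, ..., 2q - 1 in the other. Distinct ones among these points are at distance at least
    1, so every signature is respected.\<close>
  then show "if \<sigma> {u, v} then 1 \<le> circ_dist (2 * real q) (real (c u)) (real (c v))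
      else 1 \<le> circ_dist (2 * real q) (real (c u)) (antipode (2 * real q) (real (c v)))"
    unfolding circ_dist_def antipode_def by auto
qed simp

section \<open>Packing separated points on a line and on a circle\<close>

lemma separated_spread:
  fixes Y :: "real set"
  assumes "finite Y" "Y \<noteq> {}" and sep: "\<And>x y. x \<in> Y \<Longrightarrow> y \<in> Y \<Longrightarrow> x \<noteq> y \<Longrightarrow> d \<le> \<bar>x - y\<bar>"
  shows "(real (card Y) - 1) * d \<le> Max Y - Min Y"
  using assms
proof (induction Y rule: finite_linorder_max_induct)
  case (insert b A)
  show ?case
  proof (cases "A = {}")
    case False
    have IH: "(real (card A) - 1) * d \<le> Max A - Min A" using insert False by blast
    have M: "Max A \<in> A" using insert False by simp
    then have "Max A < b" using insert by blast
    moreover have "d \<le> \<bar>b - Max A\<bar>" using insert.prems(2)[of b "Max A"] M insert(2) by force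
    moreover have "Min A \<le> Max A" using insert(1) M by simp
    moreover have "card (insert b A) = Suc (card A)" using insert by auto
    moreover have "Max (insert b A) = b"
      using insert(1,2) by (intro Max_eqI) auto
    moreover have "Min (insert b A) = Min A"
      using insert(1) False \<open>Max A < b\<close> \<open>Min A \<le> Max A\<close> by simp
    ultimately show ?thesis using IH by (simp add: algebra_simps)
  qed simp
qed simp

text \<open>On the line the points leave k - 1 gaps between minimum and maximum. The upper bound L -
  d supplies the last gap, the one that closes the circle.\<close>

lemma circle_packing:
  fixes y :: "nat \<Rightarrow> real"
  assumes "k \<ge> 2" and d: "d > 0"
    and sep: "\<And>i j. i < k \<Longrightarrow> j < k \<Longrightarrow> i \<noteq> j \<Longrightarrow> d \<le> \<bar>y i - y j\<bar> \<and> \<bar>y i - y j\<bar> \<le> L - d"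
  shows "real k * d \<le> L"
proof -
  let ?Y = "y ` {..<k}"
  have inj: "inj_on y {..<k}" using sep d by (force simp: inj_on_def)
  have ne: "finite ?Y" "?Y \<noteq> {}" using assms(1) by (auto simp: lessThan_empty_iff)
  have "(real (card ?Y) - 1) * d \<le> Max ?Y - Min ?Y"
    using ne sep by (intro separated_spread) auto
  then have m: "(real k - 1) * d \<le> Max ?Y - Min ?Y" using card_image[OF inj] by simp
  obtain i j where ij: "i < k" "j < k" "Max ?Y = y i" "Min ?Y = y j"
    using Max_in[OF ne] Min_in[OF ne] by auto
  have "0 < (real k - 1) * d" using assms(1) d by simp
  then have "i \<noteq> j" using m ij by auto
  then have "\<bar>y i - y j\<bar> \<le> L - d" using sep ij by blast
  then show ?thesis using m ij by (simp add: algebra_simps)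
qed

section \<open>The lower bound from edges of both signs between large sets\<close>

definition part :: "nat \<Rightarrow> nat \<Rightarrow> nat set" where
  "part n i = {i * n..<(i + 1) * n}"

text \<open>\<open>N\<close> is the size of a part, \<open>n\<close> the size from which a subset
  counts as large.\<close>

definition both_signs_between ::
  "nat \<Rightarrow> nat \<Rightarrow> nat \<Rightarrow> nat set set \<Rightarrow> (nat set \<Rightarrow> bool) \<Rightarrow> bool" where
  "both_signs_between k N n E \<sigma> \<longleftrightarrow>
     (\<forall>i<k. \<forall>j<k. i \<noteq> j \<longrightarrow> (\<forall>A B s. A \<subseteq> part N i \<longrightarrow> B \<subseteq> part N j \<longrightarrow>
        n \<le> card A \<longrightarrow> n \<le> card B \<longrightarrow> (\<exists>a\<in>A. \<exists>b\<in>B. {a, b} \<in> E \<and> \<sigma> {a, b} = s)))"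

lemma in_partD: "v \<in> part n i \<Longrightarrow> v div n = i"
  unfolding part_def by (intro div_nat_eqI) (auto simp: mult.commute)

lemma part_subset:
  assumes "i < k"
  shows "part n i \<subseteq> {..<k * n}"
proof -
  have "(i + 1) * n \<le> k * n" using assms by (intro mult_le_mono1) simp
  then show ?thesis by (auto simp: part_def)
qed

lemma popular_value:
  fixes idx :: "'a \<Rightarrow> nat"
  assumes "finite A" "m * n \<le> card A" "\<And>v. v \<in> A \<Longrightarrow> idx v < m" "m > 0"
  shows "\<exists>p<m. n \<le> card {v \<in> A. idx v = p}"
proof (rule ccontr)
  assume *: "\<not> ?thesis"
  have "A = (\<Union>p<m. {v \<in> A. idx v = p})" using assms(3) by auto
  then have "card A \<le> (\<Sum>p<m. card {v \<in> A. idx v = p})" by (metis card_UN_le finite_lessThan)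
  also have "\<dots> < (\<Sum>p<m. n)" using * assms(4) by (intro sum_strict_mono) (auto simp: not_le lessThan_empty_iff)
  finally show False using assms(2) by simp
qed

lemma circular_coloring_lower_bound:
  fixes k m n :: nat
  assumes k: "k \<ge> 2" and m: "m > 0" and r: "r \<ge> 2"
    and col: "circular_coloring {..<k * (m * n)} E \<sigma> r f"
    and hit: "both_signs_between k (m * n) n E \<sigma>"
  shows "2 * real k * (1 - r / m) \<le> r"
\<comment> \<open>The packing bound needs a positive distance 1 - r/m; otherwise the left side is
  not positive.\<close>
proof (cases "r / m < 1")
  case False
  then have "2 * real k * (1 - r / m) \<le> 0" by (intro mult_nonneg_nonpos) auto
  then show ?thesis using r by linarith
next
  case True
  define idx where "idx v = nat \<lfloor>f v * m / r\<rfloor>" for v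
  define cls where "cls i p = {v \<in> part (m * n) i. idx v = p}" for i p
  have fr: "0 \<le> f v" "f v < r" if "v \<in> part (m * n) i" "i < k" for v i
    using col part_subset[OF that(2)] that(1) unfolding circular_coloring_def by blast+
  have idx: "real (idx v) * (r / m) \<le> f v" "f v < real (idx v) * (r / m) + r / m" "idx v < m"
    if "v \<in> part (m * n) i" "i < k" for v i
  proof -
    have nn: "0 \<le> f v * m / r" using fr[OF that] r by simp
    then have fl: "real (idx v) \<le> f v * m / r" "f v * m / r < real (idx v) + 1"
      unfolding idx_def by linarith+
    show "real (idx v) * (r / m) \<le> f v" "f v < real (idx v) * (r / m) + r / m"
      using fl m r by (auto simp: field_simps)
    have "f v * m / r < m" using fr[OF that] m r by (simp add: field_simps)
    then show "idx v < m" using fl by linarith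
  qed
  \<comment> \<open>Pigeonhole: a part has m * n vertices and there are m arcs of length
    r/m.\<close>
  have "\<exists>p<m. n \<le> card (cls i p)" if "i < k" for i
    unfolding cls_def using idx(3)[OF _ that] m by (intro popular_value) (auto simp: part_def)
  then obtain p where p: "\<And>i. i < k \<Longrightarrow> p i < m" "\<And>i. i < k \<Longrightarrow> n \<le> card (cls i (p i))" by metis
  \<comment> \<open>\<open>x i\<close> is the left end of the chosen arc, \<open>y i\<close> its
    reduction modulo r/2, which identifies antipodes.\<close>
  define x where "x i = real (p i) * (r / m)" for i
  define y where "y i = (if x i < r / 2 then x i else x i - r / 2)" for i
  have x: "0 \<le> x i" "x i < r" if "i < k" for i
    using p(1)[OF that] m r unfolding x_def by (auto simp: field_simps)
  have near_x: "x i \<le> f v" "f v < x i + r / m" "0 \<le> f v" "f v < r" if "v \<in> cls i (p i)" "i < k" for v i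
    using that idx[of v i] fr[of v i] by (auto simp: cls_def x_def)
  have "1 - r / m \<le> \<bar>y i - y j\<bar> \<and> \<bar>y i - y j\<bar> \<le> r / 2 - (1 - r / m)"
    if ij: "i < k" "j < k" "i \<noteq> j" for i j
  proof -
    have hit': "\<exists>a\<in>cls i (p i). \<exists>b\<in>cls j (p j). {a, b} \<in> E \<and> \<sigma> {a, b} = s" for s
    proof -
      have "cls i (p i) \<subseteq> part (m * n) i" "cls j (p j) \<subseteq> part (m * n) j" by (auto simp: cls_def)
      then show ?thesis using hit ij p(2) unfolding both_signs_between_def by blast
    qed
    obtain a b where ab: "a \<in> cls i (p i)" "b \<in> cls j (p j)" "{a, b} \<in> E" "\<sigma> {a, b}"
      using hit'[of True] by auto
    obtain a' b' where ab': "a' \<in> cls i (p i)" "b' \<in> cls j (p j)" "{a', b'} \<in> E" "\<not> \<sigma> {a', b'}"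
      using hit'[of False] by auto
    have pos: "1 \<le> circ_dist r (f a) (f b)" using ab col by (auto simp: circular_coloring_def)
    have neg: "1 \<le> circ_dist r (f a') (antipode r (f b'))"
      using ab' col by (auto simp: circular_coloring_def)
    \<comment> \<open>Passing from the two vertices to the left ends of their arcs changes the
      difference by less than r/m.\<close>
    have P: "1 - r / m \<le> \<bar>x i - x j\<bar>" "\<bar>x i - x j\<bar> \<le> r - (1 - r / m)"
      using pos near_x[OF ab(1) ij(1)] near_x[OF ab(2) ij(2)] unfolding circ_dist_def by linarith+
    \<comment> \<open>Whichever way the antipode wraps around, distance at least 1 on the circle
      yields the inequality for both shifts by r/2.\<close>
    have "1 \<le> \<bar>f a' - f b' - r / 2\<bar>" "1 \<le> \<bar>f a' - f b' + r / 2\<bar>"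
      using neg near_x[OF ab'(1) ij(1)] near_x[OF ab'(2) ij(2)]
      unfolding circ_dist_def antipode_def by (auto split: if_splits)
    then have N: "1 - r / m \<le> \<bar>x i - x j - r / 2\<bar>" "1 - r / m \<le> \<bar>x i - x j + r / 2\<bar>"
      using near_x[OF ab'(1) ij(1)] near_x[OF ab'(2) ij(2)] by linarith+
    \<comment> \<open>If both arcs start in the same half, P bounds the difference of the y from
      below and N from above; in opposite halves the roles are exchanged.\<close>
    show ?thesis
      using P N x[OF ij(1)] x[OF ij(2)] unfolding y_def by (auto split: if_splits)
  qed
  then have "real k * (1 - r / m) \<le> r / 2"
    using k True by (intro circle_packing[of k "1 - r / m" y "r / 2"]) auto
  then show ?thesis by linarith
qed

section \<open>Construction of the k-partite signed graph\<close>

lemma sparse_signed_multipartite: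
  fixes k m g :: nat
  assumes "k > 0" "m > 0" "g > 0"
  obtains n :: nat and E :: "nat set set" and \<sigma> :: "nat set \<Rightarrow> bool" where "n > 0" "graph {..<k * (m * n)} E" "girth_ge E g"
    "proper_coloring {..<k * (m * n)} E k (\<lambda>v. v div (m * n))"
    "both_signs_between k (m * n) n E \<sigma>"
proof -
  \<comment> \<open>With n = 4h there are k * m * n = w * h vertices. The degree bound 4 w^3 depends
    only on \<open>k\<close> and \<open>m\<close>, so \<open>h\<close> can then be chosen as the
    bound on the size of a ball.\<close>
  define w where "w = 4 * k * m"
  define h where "h = (4 * w ^ 3 + 1) ^ g"
  define n where "n = 4 * h"
  define V where "V = {..<k * (m * n)}"
  define U where "U = {(A, B, s :: bool). \<exists>i<k. \<exists>j<k. i \<noteq> j \<and> A \<subseteq> part (m * n) i \<and> B \<subseteq> part (m * n) j \<and>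
    n \<le> card A \<and> n \<le> card B}"
  have w: "w > 0" using assms by (simp add: w_def)
  have n: "n > 0" by (simp add: n_def h_def)
  have fV: "finite V" and cV: "card V \<le> w * h" by (simp_all add: V_def w_def n_def)
  have U: "\<forall>(A, B, s)\<in>U. A \<subseteq> V \<and> B \<subseteq> V \<and> 4 * h \<le> card A \<and> 4 * h \<le> card B"
    using part_subset[of _ k "m * n"] by (fastforce simp: U_def V_def n_def)
  then have "U \<subseteq> Pow V \<times> Pow V \<times> UNIV" by auto
  then have fU: "finite U" using fV finite_subset by fastforce
  have "(4 * w ^ 3 + 1) ^ g \<le> h" by (simp add: h_def)
  from sparse_signed_hitting[OF fV fU U cV this assms(3) w]
  obtain S where S: "sparse_signed V U (4 * w ^ 3) g S" and nohit: "unhit U S = {}" by blast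
  define \<sigma> where "\<sigma> e \<longleftrightarrow> (e, True) \<in> S" for e
  have inj: "inj_on fst S" using S by (simp add: sparse_signed_def)
  have sg: "\<sigma> e = s" if "(e, s) \<in> S" for e s
    using inj_onD[OF inj _ that, of "(e, True)"] that by (cases s) (auto simp: \<sigma>_def)
  show ?thesis
  proof (rule that[of n "fst ` S" \<sigma>])
    show "graph {..<k * (m * n)} (fst ` S)" "girth_ge (fst ` S) g"
      using S by (auto simp: sparse_signed_def V_def)
    show "proper_coloring {..<k * (m * n)} (fst ` S) k (\<lambda>v. v div (m * n))"
      unfolding proper_coloring_def
    proof (intro conjI ballI allI impI)
      fix v assume "v \<in> {..<k * (m * n)}"
      then show "v div (m * n) < k" by (simp add: less_mult_imp_div_less)
    next
      \<comment> \<open>Each edge comes from a triple of \<open>U\<close>, whose sets lie in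
        distinct parts.\<close>
      fix u v assume uv: "{u, v} \<in> fst ` S"
      have "\<forall>e\<in>fst ` S. \<exists>(A, B, s)\<in>U. \<exists>a\<in>A. \<exists>b\<in>B. e = {a, b}"
        using S unfolding sparse_signed_def by (elim conjE)
      from this uv have "\<exists>(A, B, s)\<in>U. \<exists>a\<in>A. \<exists>b\<in>B. {u, v} = {a, b}" by (rule bspec)
      then obtain A B s a b where *: "(A, B, s) \<in> U" "a \<in> A" "b \<in> B" "{u, v} = {a, b}" by blast
      from *(1-3) obtain i j where "i \<noteq> j" "a \<in> part (m * n) i" "b \<in> part (m * n) j"
        unfolding U_def by blast
      then have "a div (m * n) \<noteq> b div (m * n)" using in_partD by blast
      then show "u div (m * n) \<noteq> v div (m * n)" using *(4) by (auto simp: doubleton_eq_iff)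
    qed
    show "both_signs_between k (m * n) n (fst ` S) \<sigma>"
      unfolding both_signs_between_def
    proof (intro allI impI)
      fix i j A B s
      assume "i < k" "j < k" "i \<noteq> j" "A \<subseteq> part (m * n) i" "B \<subseteq> part (m * n) j" "n \<le> card A" "n \<le> card B"
      then have "(A, B, s) \<in> U" unfolding U_def by blast
      with nohit obtain a b where ab: "a \<in> A" "b \<in> B" "({a, b}, s) \<in> S" unfolding unhit_def by blast
      have "{a, b} \<in> fst ` S" using imageI[OF ab(3), of fst] by (simp only: fst_conv)
      then show "\<exists>a\<in>A. \<exists>b\<in>B. {a, b} \<in> fst ` S \<and> \<sigma> {a, b} = s"
        using ab(1,2) sg[OF ab(3)] by blast
    qed
  qed (rule n)
qed

section \<open>Choice of parameters and the two chromatic numbers\<close>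

theorem theorem2:
  fixes k g :: nat and \<epsilon> :: real
  assumes "k \<ge> 2" and "g \<ge> 3" and "\<epsilon> > 0"
  shows "\<exists>V E \<sigma>. graph V E \<and> girth_ge E g \<and> chromatic_number V E = k \<and>
           circular_chromatic_number V E \<sigma> > 2 * real k - \<epsilon>"
proof -
  \<comment> \<open>Strictly below \<epsilon> because the infimum yields only a weak inequality;
    below 1 so that 2k - \<delta> exceeds 2(k - 1).\<close>
  define \<delta> where "\<delta> = min \<epsilon> 1 / 2"
  have \<delta>: "0 < \<delta>" "\<delta> < \<epsilon>" "\<delta> < 1" using assms(3) by (auto simp: \<delta>_def)
  \<comment> \<open>For r <= 2k the loss 2k * r/m in the lower bound is at most 4k^2/m, hence at
    most \<delta>.\<close>
  obtain m :: nat where "4 * (real k)\<^sup>2 / \<delta> < real m" using reals_Archimedean2 by blast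
  then have m: "4 * (real k)\<^sup>2 \<le> \<delta> * real m" using \<delta> by (simp add: field_simps)
  have "0 < 4 * (real k)\<^sup>2" using assms(1) by simp
  then have m0: "m > 0" using m by (cases m) auto
  obtain n E \<sigma> where G: "n > 0" "graph {..<k * (m * n)} E" "girth_ge E g"
    "proper_coloring {..<k * (m * n)} E k (\<lambda>v. v div (m * n))"
    and hit: "both_signs_between k (m * n) n E \<sigma>"
    using sparse_signed_multipartite[of k m g] assms m0 by auto
  let ?V = "{..<k * (m * n)}"
  have bound: "2 * real k - \<delta> \<le> r" if r: "r \<ge> 2" and f: "circular_coloring ?V E \<sigma> r f" for r f
  proof (cases "r \<le> 2 * real k")
    case True
    have "2 * real k * (1 - r / m) \<le> r"
      using circular_coloring_lower_bound[OF assms(1) m0 r f hit] .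
    moreover have "2 * real k * (r / m) \<le> 2 * real k * (2 * real k / m)"
      using True m0 by (intro mult_left_mono divide_right_mono) simp_all
    moreover have "2 * real k * (2 * real k / m) \<le> \<delta>"
      using m m0 by (simp add: field_simps power2_eq_square)
    ultimately show ?thesis by (simp add: algebra_simps)
  next
    case False
    then show ?thesis using \<delta> by linarith
  qed
  have "chromatic_number ?V E = k"
    unfolding chromatic_number_def
  proof (rule Least_equality)
    show "\<exists>c. proper_coloring ?V E k c" using G by blast
  next
    fix q assume "\<exists>c. proper_coloring ?V E q c"
    then obtain c where c: "proper_coloring ?V E q c" by blast
    show "k \<le> q"
    proof (rule ccontr)
      assume "\<not> k \<le> q"
      \<comment> \<open>Passing from q to k - 1 colours ensures circumference 2(k - 1) >= 2, as
        \<open>bound\<close> requires; q itself might be 0.\<close>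
      then have "proper_coloring ?V E (k - 1) c" using c by (force simp: proper_coloring_def)
      from circular_coloring_of_proper[OF G(2) this, of \<sigma>] assms(1)
      have "2 * real k - \<delta> \<le> 2 * real (k - 1)" by (intro bound) auto
      then show False using \<delta> assms(1) by (simp add: of_nat_diff)
    qed
  qed
  moreover have "2 * real k - \<delta> \<le> circular_chromatic_number ?V E \<sigma>"
    unfolding circular_chromatic_number_def
  proof (rule cInf_greatest)
    \<comment> \<open>Nonemptiness of the set, without which its \<open>Inf\<close> would carry no
      information.\<close>
    have "2 * real k \<in> {r. r \<ge> 2 \<and> (\<exists>f. circular_coloring ?V E \<sigma> r f)}"
      using circular_coloring_of_proper[OF G(2,4)] assms(1) by auto
    then show "{r. r \<ge> 2 \<and> (\<exists>f. circular_coloring ?V E \<sigma> r f)} \<noteq> {}" by blast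
  qed (use bound in blast)
  ultimately show ?thesis using G \<delta> by (intro exI[of _ ?V] exI[of _ E] exI[of _ \<sigma>]) auto
qed

end
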